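(* Let $G$ be a finite simple undirected graph and let $H$ be obtained from $G$ by inserting a new vertex $v$ with an arbitrary neighborhood $N(v)\subseteq V_G$ (i.e. $H=(V_G\cup\{v\},E_G\cup\{\{v,v'\}:v'\in N(v)\})$). Then \[\operatorname{nlcw}(G)\le\operatorname{nlcw}(H)\le 2\operatorname{nlcw}(G)\quad\text{and}\quad \operatorname{cw}(G)\le\operatorname{cw}(H)\le 2\operatorname{cw}(G).\]
   Context: Clique-width: for a positive integer $k$, $\mathrm{CW}_k$ is the smallest class of graphs whose vertices carry labels from $\{1,\dots,k\}$ that contains every single-vertex graph with any label and is closed under: disjoint union; relabeling $\rho_{a\to b}$ for $a\neq b$; and $\eta_{a,b}$ for $a\neq b$ (add all edges between vertices labeled $a$ and vertices labeled $b$). $\operatorname{cw}(G)$ is the least $k$ such that some labeling of $G$ lies in $\mathrm{CW}_k$. NLC-width: $\mathrm{NLC}_k$ is the smallest class of labeled graphs (labels in $\{1,\dots,k\}$) containing every single-vertex graph with any label and closed under: $G\times_S J$ for $S\subseteq\{1,\dots,k\}^2$ (disjoint union of vertex-disjoint $G$ and $J$ plus all edges $\{u,v\}$, $u\in V_G$, $v\in V_J$, $(\mathrm{lab}(u),\mathrm{lab}(v))\in S$); and $\circ_R$ for $R:\{1,\dots,k\}\to\{1,\dots,k\}$. $\operatorname{nlcw}(G)$ is the least $k$ such that some labeling of $G$ lies in $\mathrm{NLC}_k$. *)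

theory Defs
  imports Main "HOL-Library.FuncSet"
begin

definition simple_graph :: "'a set \<Rightarrow> 'a set set \<Rightarrow> bool" where
  "simple_graph V E \<longleftrightarrow> finite V \<and> (\<forall>e\<in>E. e \<subseteq> V \<and> card e = 2)"

text \<open>
  A labeled graph is a triple of a vertex set, a set of two-element edges and a labeling,
  given as a partial map whose domain is exactly the vertex set in every member of the two
  classes below. Hence conditions of the form \<open>lab u = Some a\<close> already say that \<open>u\<close> is a vertex.
\<close>

type_synonym 'a lgraph = "'a set \<times> 'a set set \<times> ('a \<rightharpoonup> nat)"

inductive_set CW :: "nat \<Rightarrow> 'a lgraph set" for k :: nat where
  single: "a \<in> {1..k} \<Longrightarrow> ({v}, {}, [v \<mapsto> a]) \<in> CW k"
| union: "(V, E, lab) \<in> CW k \<Longrightarrow> (V', E', lab') \<in> CW k \<Longrightarrow> V \<inter> V' = {} \<Longrightarrow>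
    (V \<union> V', E \<union> E', lab ++ lab') \<in> CW k"
| relabel: "(V, E, lab) \<in> CW k \<Longrightarrow> a \<in> {1..k} \<Longrightarrow> b \<in> {1..k} \<Longrightarrow> a \<noteq> b \<Longrightarrow>
    (V, E, map_option (\<lambda>c. if c = a then b else c) \<circ> lab) \<in> CW k"
| join: "(V, E, lab) \<in> CW k \<Longrightarrow> a \<in> {1..k} \<Longrightarrow> b \<in> {1..k} \<Longrightarrow> a \<noteq> b \<Longrightarrow>
    (V, E \<union> {{u, w} | u w. lab u = Some a \<and> lab w = Some b}, lab) \<in> CW k"

inductive_set NLC :: "nat \<Rightarrow> 'a lgraph set" for k :: nat where
  single: "a \<in> {1..k} \<Longrightarrow> ({v}, {}, [v \<mapsto> a]) \<in> NLC k"
| product: "(V, E, lab) \<in> NLC k \<Longrightarrow> (V', E', lab') \<in> NLC k \<Longrightarrow> V \<inter> V' = {} \<Longrightarrow>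
    S \<subseteq> {1..k} \<times> {1..k} \<Longrightarrow>
    (V \<union> V',
     E \<union> E' \<union> {{u, w} | u w a b. lab u = Some a \<and> lab' w = Some b \<and> (a, b) \<in> S},
     lab ++ lab') \<in> NLC k"
| relabel: "(V, E, lab) \<in> NLC k \<Longrightarrow> R \<in> {1..k} \<rightarrow> {1..k} \<Longrightarrow>
    (V, E, map_option R \<circ> lab) \<in> NLC k"

text \<open>
  Both widths are meaningful for finite nonempty simple graphs only: the null graph is in
  neither class for any \<open>k\<close>.
\<close>

definition cw :: "'a set \<Rightarrow> 'a set set \<Rightarrow> nat" where
  "cw V E = (LEAST k. 1 \<le> k \<and> (\<exists>lab. (V, E, lab) \<in> CW k))"

definition nlcw :: "'a set \<Rightarrow> 'a set set \<Rightarrow> nat" where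
  "nlcw V E = (LEAST k. 1 \<le> k \<and> (\<exists>lab. (V, E, lab) \<in> NLC k))"

end

theory Submission
  imports Defs
begin

text \<open>
  Both classes are closed under nonempty induced subgraphs, which gives the lower bounds. For the
  upper bounds, the label set is doubled so that every label also records membership in the
  neighborhood \<open>N\<close> of the new vertex; at the end \<open>v\<close> can be attached to exactly the vertices
  carrying a label of the second kind. In the clique-width case \<open>v\<close> needs a label that occurs
  nowhere else, which is available after merging labels if \<open>k \<ge> 2\<close>; for \<open>k = 1\<close> the graph \<open>G\<close> is
  edgeless and \<open>H\<close> is a star plus isolated vertices.
\<close>

section \<open>Well-formedness and induced subgraphs\<close>

text \<open>\<open>dom lab = V\<close> lets label conditions stand for vertex membership, and the
  range bound makes a shift of labels by \<open>k\<close> decodable. \<open>{} \<notin> E\<close>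
  matters because an empty edge would survive restriction to any vertex set.\<close>

lemma CW_wf:
  "(V, E, lab) \<in> CW k \<Longrightarrow> dom lab = V \<and> ran lab \<subseteq> {1..k} \<and> E \<subseteq> Pow V \<and> {} \<notin> E"
proof (induction rule: CW.induct)
  case (union V E lab V' E' lab')
  then show ?case by (auto simp: ran_def dom_def map_add_def split: option.splits)
qed (auto simp: ran_def dom_def)

lemma NLC_wf:
  "(V, E, lab) \<in> NLC k \<Longrightarrow> dom lab = V \<and> ran lab \<subseteq> {1..k} \<and> E \<subseteq> Pow V \<and> {} \<notin> E"
proof (induction rule: NLC.induct)
  case (product V E lab V' E' lab' S)
  then show ?case by (auto simp: ran_def dom_def map_add_def split: option.splits)
qed (auto simp: ran_def dom_def)

lemma restrict_map_map_add: "(f ++ g) |` W = (f |` W) ++ (g |` W)"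
  by (auto simp: fun_eq_iff restrict_map_def map_add_def)

lemma restrict_map_map_option: "(\<lambda>u. map_option f (g u)) |` W = (\<lambda>u. map_option f ((g |` W) u))"
  by (auto simp: fun_eq_iff restrict_map_def)

lemma restrict_map_disjoint_dom: "dom f \<inter> W = {} \<Longrightarrow> f |` W = Map.empty"
  by (auto simp: fun_eq_iff restrict_map_def)

lemma restrict_map_singleton:
  "v \<in> W \<Longrightarrow> (\<lambda>u. if u = v then Some a else None) |` W = [v \<mapsto> a]"
  by (auto simp: fun_eq_iff restrict_map_def)

text \<open>An edge inside both \<open>V\<close> and \<open>W\<close> would lie in their empty
  intersection. This disposes of the edges of an operand that \<open>W\<close> misses
  completely.\<close>

lemma no_edges_inside:
  assumes "E \<subseteq> Pow V" "{} \<notin> E" "V \<inter> W = {}"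
  shows "{e \<in> E. e \<subseteq> W} = {}"
proof -
  have "e = {}" if "e \<in> E" "e \<subseteq> W" for e using that assms by auto
  then show ?thesis using assms(2) by auto
qed

text \<open>Each operation of the construction commutes with restriction to \<open>W\<close>. The
  exception is a union in which one operand misses \<open>W\<close>: there the restriction of the
  other operand is already the result.\<close>

lemma CW_induced_subgraph:
  assumes "(V, E, lab) \<in> CW k" and "V \<inter> W \<noteq> {}"
  shows "(V \<inter> W, {e \<in> E. e \<subseteq> W}, lab |` W) \<in> CW k"
  using assms
proof (induction rule: CW.induct)
  case (single a v)
  then have "v \<in> W" by auto
  with CW.single[OF single(1), of v] show ?case by (simp add: restrict_map_singleton fun_upd_def)
next
  case (union V E lab V' E' lab')
  note wf = CW_wf[OF union.hyps(1)] CW_wf[OF union.hyps(2)]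
  have edges: "{e \<in> E \<union> E'. e \<subseteq> W} = {e \<in> E. e \<subseteq> W} \<union> {e \<in> E'. e \<subseteq> W}" by auto
  \<comment> \<open>The null graph lies in no \<open>CW k\<close>, so the induction hypothesis says
    nothing about an operand missing \<open>W\<close>; that operand is dropped.\<close>
  consider "V \<inter> W = {}" "V' \<inter> W \<noteq> {}" | "V \<inter> W \<noteq> {}" "V' \<inter> W = {}"
    | "V \<inter> W \<noteq> {}" "V' \<inter> W \<noteq> {}" using union.prems by blast
  then show ?case
  proof cases
    case 1
    have "{e \<in> E. e \<subseteq> W} = {}" using wf(1) 1(1) no_edges_inside by metis
    moreover have "lab |` W = Map.empty" using wf(1) 1(1) by (simp add: restrict_map_disjoint_dom)
    ultimately show ?thesis unfolding edges
      using union.IH(2)[OF 1(2)] 1(1)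
      by (simp add: restrict_map_map_add Int_Un_distrib2 del: Collect_empty_eq)
  next
    case 2
    have "{e \<in> E'. e \<subseteq> W} = {}" using wf(2) 2(2) no_edges_inside by metis
    moreover have "lab' |` W = Map.empty" using wf(2) 2(2) by (simp add: restrict_map_disjoint_dom)
    ultimately show ?thesis unfolding edges
      using union.IH(1)[OF 2(1)] 2(2)
      by (simp add: restrict_map_map_add Int_Un_distrib2 del: Collect_empty_eq)
  next
    case 3
    have "V \<inter> W \<inter> (V' \<inter> W) = {}" using union.hyps(3) by blast
    from CW.union[OF union.IH(1)[OF 3(1)] union.IH(2)[OF 3(2)] this]
    show ?thesis unfolding edges by (simp add: restrict_map_map_add Int_Un_distrib2)
  qed
next
  case (relabel V E lab a b)
  then show ?case using CW.relabel[OF relabel.IH] by (simp add: restrict_map_map_option comp_def)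
next
  case (join V E lab a b)
  have "{e \<in> E \<union> {{u, w} |u w. lab u = Some a \<and> lab w = Some b}. e \<subseteq> W}
      = {e \<in> E. e \<subseteq> W} \<union> {{u, w} |u w. (lab |` W) u = Some a \<and> (lab |` W) w = Some b}"
    by (fastforce simp: restrict_map_def split: if_splits)
  then show ?case using CW.join[OF join.IH[OF join.prems] join.hyps(2-4)] by simp
qed

lemma NLC_induced_subgraph:
  assumes "(V, E, lab) \<in> NLC k" and "V \<inter> W \<noteq> {}"
  shows "(V \<inter> W, {e \<in> E. e \<subseteq> W}, lab |` W) \<in> NLC k"
  using assms
proof (induction rule: NLC.induct)
  case (single a v)
  then have "v \<in> W" by auto
  with NLC.single[OF single(1), of v] show ?case by (simp add: restrict_map_singleton fun_upd_def)
next
  case (product V E lab V' E' lab' S)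
  note wf = NLC_wf[OF product.hyps(1)] NLC_wf[OF product.hyps(2)]
  let ?new = "\<lambda>l l'. {{u, w} |u w a b. l u = Some a \<and> l' w = Some b \<and> (a, b) \<in> S}"
  \<comment> \<open>A product edge lies inside \<open>W\<close> iff both ends keep their labels
    under restriction. In particular no product edge remains when one restricted labeling is
    empty.\<close>
  have edges: "{e \<in> E \<union> E' \<union> ?new lab lab'. e \<subseteq> W}
      = {e \<in> E. e \<subseteq> W} \<union> {e \<in> E'. e \<subseteq> W} \<union> ?new (lab |` W) (lab' |` W)"
    by (fastforce simp: restrict_map_def split: if_splits)
  consider "V \<inter> W = {}" "V' \<inter> W \<noteq> {}" | "V \<inter> W \<noteq> {}" "V' \<inter> W = {}"
    | "V \<inter> W \<noteq> {}" "V' \<inter> W \<noteq> {}" using product.prems by blast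
  then show ?case
  proof cases
    case 1
    have "{e \<in> E. e \<subseteq> W} = {}" using wf(1) 1(1) no_edges_inside by metis
    moreover have "lab |` W = Map.empty" using wf(1) 1(1) by (simp add: restrict_map_disjoint_dom)
    ultimately show ?thesis unfolding edges
      using product.IH(2)[OF 1(2)] 1(1)
      by (simp add: restrict_map_map_add Int_Un_distrib2 del: Collect_empty_eq)
  next
    case 2
    have "{e \<in> E'. e \<subseteq> W} = {}" using wf(2) 2(2) no_edges_inside by metis
    moreover have "lab' |` W = Map.empty" using wf(2) 2(2) by (simp add: restrict_map_disjoint_dom)
    ultimately show ?thesis unfolding edges
      using product.IH(1)[OF 2(1)] 2(2)
      by (simp add: restrict_map_map_add Int_Un_distrib2 del: Collect_empty_eq)
  next
    case 3
    have "V \<inter> W \<inter> (V' \<inter> W) = {}" using product.hyps(3) by blast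
    from NLC.product[OF product.IH(1)[OF 3(1)] product.IH(2)[OF 3(2)] this product.hyps(4)]
    show ?thesis unfolding edges by (simp add: restrict_map_map_add Int_Un_distrib2)
  qed
next
  case (relabel V E lab R)
  then show ?case using NLC.relabel[OF relabel.IH] by (simp add: restrict_map_map_option comp_def)
qed

section \<open>Doubling the labels\<close>

text \<open>Encodes the pair of an old label in \<open>{1..k}\<close> and a membership bit as one
  number in \<open>{1..2*k}\<close>: the upper half is the copy for \<open>N\<close>. The set
  \<open>N\<close> stays fixed through the whole construction and may contain vertices absent from a
  given intermediate graph.\<close>

definition split_labels :: "nat \<Rightarrow> 'a set \<Rightarrow> ('a \<rightharpoonup> nat) \<Rightarrow> 'a \<rightharpoonup> nat" where
  "split_labels k N lab = (\<lambda>u. map_option (\<lambda>a. if u \<in> N then a + k else a) (lab u))"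

lemma split_labels_map_add:
  "split_labels k N (f ++ g) = split_labels k N f ++ split_labels k N g"
  by (auto simp: split_labels_def fun_eq_iff map_add_def split: option.splits)

lemma split_labels_single:
  "split_labels k N [v \<mapsto> a] = [v \<mapsto> if v \<in> N then a + k else a]"
  by (auto simp: split_labels_def fun_eq_iff)

lemma split_labels_eq_Some:
  "split_labels k N lab u = Some c \<longleftrightarrow>
    (\<exists>a. lab u = Some a \<and> c = (if u \<in> N then a + k else a))"
  by (auto simp: split_labels_def)

text \<open>The membership bit is set when a vertex is created and never changed. Products ignore
  it, and relabelings act on the two copies in parallel.\<close>

lemma NLC_split_labels:
  "(V, E, lab) \<in> NLC k \<Longrightarrow> (V, E, split_labels k N lab) \<in> NLC (2 * k)"
proof (induction rule: NLC.induct)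
  case (single a v)
  then show ?case unfolding split_labels_single by (intro NLC.single) auto
next
  case (product V E lab V' E' lab' S)
  note wf = NLC_wf[OF product.hyps(1)] NLC_wf[OF product.hyps(2)]
  \<comment> \<open>\<open>f\<close> forgets the membership bit, and \<open>S'\<close> is the
    preimage of \<open>S\<close> under \<open>f\<close> in both coordinates.\<close>
  define f where "f c = (if c > k then c - k else c)" for c
  define S' where "S' = {(a, b) \<in> {1..2*k} \<times> {1..2*k}. (f a, f b) \<in> S}"
  have S'_iff: "(if u \<in> N then a + k else a, if w \<in> N then b + k else b) \<in> S' \<longleftrightarrow> (a, b) \<in> S"
    if "lab u = Some a" "lab' w = Some b" for u w a b
  proof -
    have "a \<in> {1..k}" "b \<in> {1..k}" using that wf by (auto simp: ran_def)
    then show ?thesis by (auto simp: S'_def f_def)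
  qed
  have "{{u, w} |u w a b. split_labels k N lab u = Some a \<and> split_labels k N lab' w = Some b
        \<and> (a, b) \<in> S'}
      = {{u, w} |u w a b. lab u = Some a \<and> lab' w = Some b \<and> (a, b) \<in> S}"
    unfolding split_labels_eq_Some using S'_iff by blast
  moreover have "S' \<subseteq> {1..2*k} \<times> {1..2*k}" by (auto simp: S'_def)
  ultimately show ?case
    using NLC.product[OF product.IH product.hyps(3), of S'] by (simp add: split_labels_map_add)
next
  case (relabel V E lab R)
  note wf = NLC_wf[OF relabel.hyps(1)]
  define R' where "R' c = (if c \<le> k then R c else R (c - k) + k)" for c
  have "R' \<in> {1..2*k} \<rightarrow> {1..2*k}"
  proof
    fix c assume c: "c \<in> {1..2*k}"
    show "R' c \<in> {1..2*k}"
    proof (cases "c \<le> k")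
      case True
      then have "R c \<in> {1..k}" using c by (intro funcset_mem[OF relabel.hyps(2)]) auto
      then show ?thesis using True by (auto simp: R'_def)
    next
      case False
      then have "R (c - k) \<in> {1..k}" using c by (intro funcset_mem[OF relabel.hyps(2)]) auto
      then show ?thesis using False by (auto simp: R'_def)
    qed
  qed
  moreover have "split_labels k N (map_option R \<circ> lab) = map_option R' \<circ> split_labels k N lab"
  proof
    fix u
    show "split_labels k N (map_option R \<circ> lab) u = (map_option R' \<circ> split_labels k N lab) u"
    proof (cases "lab u")
      case (Some a)
      then have "a \<in> {1..k}" using wf by (auto simp: ran_def)
      then show ?thesis using Some by (auto simp: split_labels_def R'_def)
    qed (simp add: split_labels_def)
  qed
  ultimately show ?case using NLC.relabel[OF relabel.IH] by (simp add: comp_def)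
qed

text \<open>With only elementary operations available, one relabeling becomes two, one per copy, and
  one join becomes four, one per pair of copies.\<close>

lemma CW_split_labels:
  "(V, E, lab) \<in> CW k \<Longrightarrow> (V, E, split_labels k N lab) \<in> CW (2 * k)"
proof (induction rule: CW.induct)
  case (single a v)
  then show ?case unfolding split_labels_single by (intro CW.single) auto
next
  case (union V E lab V' E' lab')
  then show ?case unfolding split_labels_map_add by (intro CW.union)
next
  case (relabel V E lab a b)
  note wf = CW_wf[OF relabel.hyps(1)]
  let ?r = "\<lambda>a b c. if c = a then b else c :: nat"
  \<comment> \<open>The two relabelings do not interfere: the first involves only labels at most
    \<open>k\<close>, the second only labels above \<open>k\<close>.\<close>
  have "split_labels k N (map_option (?r a b) \<circ> lab)
      = map_option (?r (a + k) (b + k)) \<circ> (map_option (?r a b) \<circ> split_labels k N lab)"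
  proof
    fix u
    show "split_labels k N (map_option (?r a b) \<circ> lab) u
      = (map_option (?r (a + k) (b + k)) \<circ> (map_option (?r a b) \<circ> split_labels k N lab)) u"
    proof (cases "lab u")
      case (Some c)
      then have "c \<in> {1..k}" using wf by (auto simp: ran_def)
      then show ?thesis using Some relabel.hyps by (auto simp: split_labels_def)
    qed (simp add: split_labels_def)
  qed
  moreover have "(V, E, map_option (?r (a + k) (b + k)) \<circ>
      (map_option (?r a b) \<circ> split_labels k N lab)) \<in> CW (2 * k)"
    by (rule CW.relabel, rule CW.relabel, rule relabel.IH) (use relabel.hyps in auto)
  ultimately show ?case by (simp add: comp_def)
next
  case (join V E lab a b)
  note wf = CW_wf[OF join.hyps(1)]
  let ?l = "split_labels k N lab"
  let ?new = "\<lambda>l a b. {{u, w} |u w. l u = Some a \<and> l w = Some (b :: nat)}"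
  have l_iff: "lab u = Some c \<longleftrightarrow> ?l u = Some c \<or> ?l u = Some (c + k)" if "c \<in> {1..k}" for u c
  proof (cases "lab u")
    case (Some d)
    then have "d \<in> {1..k}" using wf by (auto simp: ran_def)
    then show ?thesis using Some that by (auto simp: split_labels_def)
  qed (simp add: split_labels_def)
  have "?new lab a b = ?new ?l a b \<union> ?new ?l a (b + k) \<union> ?new ?l (a + k) b
      \<union> ?new ?l (a + k) (b + k)"
    unfolding l_iff[OF join.hyps(2)] l_iff[OF join.hyps(3)] by blast
  \<comment> \<open>Every join here uses two distinct labels: \<open>a \<noteq> b\<close> settles
    equal copies, and different copies lie on different sides of \<open>k\<close>.\<close>
  moreover have "(V, E \<union> ?new ?l a b \<union> ?new ?l a (b + k) \<union> ?new ?l (a + k) b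
      \<union> ?new ?l (a + k) (b + k), ?l) \<in> CW (2 * k)"
    by (rule CW.join, rule CW.join, rule CW.join, rule CW.join, rule join.IH)
      (use join.hyps in auto)
  ultimately show ?case by (simp add: Un_assoc)
qed

section \<open>Attaching the new vertex\<close>

lemma NLC_insert_vertex:
  assumes G: "(V, E, lab) \<in> NLC k" and "v \<notin> V" "N \<subseteq> V" and k: "1 \<le> k"
  shows "\<exists>lab. (insert v V, E \<union> {{v, v'} | v'. v' \<in> N}, lab) \<in> NLC (2 * k)"
proof -
  note wf = NLC_wf[OF G]
  let ?l = "split_labels k N lab"
  \<comment> \<open>The new vertex may share label 1 with old vertices, since a product adds edges
    only between its two operands.\<close>
  define S where "S = {k + 1..2 * k} \<times> {1::nat}"
  have N_iff: "(\<exists>c. ?l u = Some c \<and> (c, 1) \<in> S) \<longleftrightarrow> u \<in> N" for u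
  proof (cases "lab u")
    case None
    then have "u \<notin> N" using wf assms(3) by auto
    then show ?thesis using None by (simp add: split_labels_def)
  next
    case (Some d)
    then have "d \<in> {1..k}" using wf by (auto simp: ran_def)
    then show ?thesis using Some by (auto simp: split_labels_def S_def)
  qed
  have "{{u, w} |u w a b. ?l u = Some a \<and> [v \<mapsto> 1] w = Some b \<and> (a, b) \<in> S}
      = {{u, v} |u. \<exists>c. ?l u = Some c \<and> (c, 1) \<in> S}"
    by (auto split: if_splits)
  also have "\<dots> = {{v, v'} |v'. v' \<in> N}"
    unfolding N_iff by (simp add: insert_commute)
  finally have edges: "{{u, w} |u w a b. ?l u = Some a \<and> [v \<mapsto> 1] w = Some b \<and> (a, b) \<in> S}
      = {{v, v'} |v'. v' \<in> N}" .
  have "S \<subseteq> {1..2 * k} \<times> {1..2 * k}" using k by (auto simp: S_def)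
  moreover have "({v}, {}, [v \<mapsto> 1]) \<in> NLC (2 * k)" using k by (intro NLC.single) auto
  ultimately have "(V \<union> {v}, E \<union> {} \<union> {{v, v'} |v'. v' \<in> N}, ?l ++ [v \<mapsto> 1]) \<in> NLC (2 * k)"
    using NLC.product[OF NLC_split_labels[OF G, of N], of "{v}" "{}" "[v \<mapsto> 1]" S] assms(2)
    unfolding edges by blast
  then show ?thesis by auto
qed

text \<open>Merges a whole set of labels by induction on \<open>A\<close>, one elementary relabeling
  at a time.\<close>

lemma CW_relabel_set:
  assumes "(V, E, lab) \<in> CW k" and "A \<subseteq> {1..k}" and "b \<in> {1..k}"
  shows "(V, E, map_option (\<lambda>c. if c \<in> A then b else c) \<circ> lab) \<in> CW k"
proof -
  have "finite A" using assms(2) finite_subset by blast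
  then show ?thesis using assms(2)
  proof (induction A)
    case empty
    then show ?case using assms(1) by (simp add: option.map_ident comp_def)
  next
    case (insert x A)
    show ?case
    \<comment> \<open>An elementary relabeling requires distinct labels, but sending
      \<open>b\<close> to itself changes nothing and can be skipped.\<close>
    proof (cases "x = b")
      case True
      then have "(\<lambda>c. if c \<in> insert x A then b else c) = (\<lambda>c. if c \<in> A then b else c)" by auto
      then show ?thesis using insert by simp
    next
      case False
      have "map_option (\<lambda>c. if c \<in> insert x A then b else c) \<circ> lab
        = map_option (\<lambda>c. if c = x then b else c) \<circ> (map_option (\<lambda>c. if c \<in> A then b else c) \<circ> lab)"
        using False by (auto simp: fun_eq_iff option.map_comp comp_def intro!: option.map_cong)
      then show ?thesis
        using CW.relabel[of V E "map_option (\<lambda>c. if c \<in> A then b else c) \<circ> lab" k x b]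
          insert False assms(3) by (simp add: comp_def)
    qed
  qed
qed

lemma CW_edgeless:
  assumes "finite V" "V \<noteq> {}" "a \<in> {1..k}"
  shows "(V, {}, \<lambda>u. if u \<in> V then Some a else None) \<in> CW k"
  using assms(1,2)
proof (induction rule: finite_ne_induct)
  case (singleton x)
  have "(\<lambda>u. if u \<in> {x} then Some a else None) = [x \<mapsto> a]" by auto
  then show ?case using CW.single[OF assms(3), of x] by simp
next
  case (insert x F)
  have "(\<lambda>u. if u \<in> insert x F then Some a else None)
      = [x \<mapsto> a] ++ (\<lambda>u. if u \<in> F then Some a else None)"
    by (auto simp: fun_eq_iff map_add_def)
  then show ?case using CW.union[OF CW.single[OF assms(3), of x] insert.IH] insert.hyps by simp
qed

lemma CW_finite: "(V, E, lab) \<in> CW k \<Longrightarrow> finite V"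
  by (induction rule: CW.induct) auto

text \<open>Edges arise only from joins, and a join needs two distinct labels.\<close>

lemma CW_1_edgeless: "(V, E, lab) \<in> CW 1 \<Longrightarrow> E = {}"
  by (induction rule: CW.induct) auto

text \<open>The center gets label 1 and all leaves label 2, so a single join suffices. An empty leaf
  set is separate because \<open>CW_edgeless\<close> cannot produce the null graph.\<close>

lemma CW_2_star:
  assumes "finite N" "v \<notin> N"
  shows "\<exists>lab. (insert v N, {{v, v'} | v'. v' \<in> N}, lab) \<in> CW 2"
proof (cases "N = {}")
  case True
  then show ?thesis using CW.single[of 1 2 v] by auto
next
  case False
  let ?l = "[v \<mapsto> 1::nat] ++ (\<lambda>u. if u \<in> N then Some (2::nat) else None)"
  have "({v} \<union> N, {} \<union> {}, ?l) \<in> CW 2"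
    by (rule CW.union, rule CW.single, simp, rule CW_edgeless) (use assms False in auto)
  from CW.join[OF this, of 1 2]
  have "({v} \<union> N, {{u, w} |u w. ?l u = Some 1 \<and> ?l w = Some 2}, ?l) \<in> CW 2" by simp
  moreover have "?l u = Some 1 \<longleftrightarrow> u = v" "?l u = Some 2 \<longleftrightarrow> u \<in> N" for u
    using assms(2) by (auto simp: map_add_def)
  ultimately show ?thesis by auto
qed

lemma CW_insert_vertex:
  assumes G: "(V, E, lab) \<in> CW k" and "v \<notin> V" "N \<subseteq> V" and k: "1 \<le> k"
  shows "\<exists>lab. (insert v V, E \<union> {{v, v'} | v'. v' \<in> N}, lab) \<in> CW (2 * k)"
proof (cases "k = 1")
  case True
  have fin: "finite V" using CW_finite[OF G] .
  obtain l where l: "(insert v N, {{v, v'} | v'. v' \<in> N}, l) \<in> CW 2"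
    using CW_2_star[of N v] assms(2,3) finite_subset[OF _ fin] by blast
  have "E = {}" using CW_1_edgeless G True by blast
  show ?thesis
  proof (cases "V - N = {}")
    case True
    then have "V = N" using assms(3) by auto
    then show ?thesis using l \<open>E = {}\<close> \<open>k = 1\<close> by auto
  next
    case False
    \<comment> \<open>The non-neighbors are added as isolated vertices. Sharing a label with the
      star is harmless, as no join follows.\<close>
    have "(V - N, {}, \<lambda>u. if u \<in> V - N then Some 1 else None) \<in> CW 2"
      using fin False by (intro CW_edgeless) auto
    from CW.union[OF l this] assms(2)
    have "\<exists>l. (insert v N \<union> (V - N), {{v, v'} | v'. v' \<in> N}, l) \<in> CW 2" by auto
    moreover have "insert v N \<union> (V - N) = insert v V" using assms(3) by auto
    ultimately show ?thesis using \<open>E = {}\<close> \<open>k = 1\<close> by auto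
  qed
next
  case False
  then have k2: "2 \<le> k" using k by simp
  note wf = CW_wf[OF G]
  let ?m = "\<lambda>A b c. if c \<in> A then b else c :: nat"
  \<comment> \<open>After splitting, only the membership bit matters: vertices outside
    \<open>N\<close> collapse to label 1 and those in \<open>N\<close> to \<open>k + 1\<close>.
    Label 2 is then free for \<open>v\<close>, because \<open>2 \<le> k\<close> keeps it distinct
    from \<open>k + 1\<close>; for \<open>k = 1\<close> the two would coincide.\<close>
  define l where "l = map_option (?m {k + 1..2 * k} (k + 1)) \<circ>
    (map_option (?m {1..k} 1) \<circ> split_labels k N lab)"
  have "(V, E, l) \<in> CW (2 * k)" unfolding l_def
    by (rule CW_relabel_set, rule CW_relabel_set, rule CW_split_labels, rule G) (use k in auto)
  moreover have "({v}, {}, [v \<mapsto> 2]) \<in> CW (2 * k)" using k2 by (intro CW.single) auto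
  ultimately have "({v} \<union> V, {} \<union> E, [v \<mapsto> 2] ++ l) \<in> CW (2 * k)"
    using assms(2) by (intro CW.union) auto
  from CW.join[OF this, of 2 "k + 1"]
  have "(insert v V, E \<union> {{u, w} |u w. ([v \<mapsto> 2] ++ l) u = Some 2 \<and>
      ([v \<mapsto> 2] ++ l) w = Some (k + 1)}, [v \<mapsto> 2] ++ l) \<in> CW (2 * k)"
    using k2 by simp
  moreover have l_eq: "l u = (if u \<in> V then Some (if u \<in> N then k + 1 else 1) else None)" for u
  proof (cases "lab u")
    case None
    then show ?thesis using wf by (auto simp: l_def split_labels_def)
  next
    case (Some d)
    then have "d \<in> {1..k}" "u \<in> V" using wf by (auto simp: ran_def)
    then show ?thesis using Some by (auto simp: l_def split_labels_def)
  qed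
  have "([v \<mapsto> 2] ++ l) u = Some 2 \<longleftrightarrow> u = v" "([v \<mapsto> 2] ++ l) u = Some (k + 1) \<longleftrightarrow> u \<in> N" for u
    using k2 assms(2,3) by (auto simp: map_add_def l_eq)
  ultimately show ?thesis by auto
qed

section \<open>Widths\<close>

text \<open>\<open>P k V E\<close> abstracts "some labeling of the graph lies in the class for
  \<open>k\<close>", so that one argument serves both widths.\<close>

lemma Least_width_insert_vertex:
  fixes P :: "nat \<Rightarrow> 'a set \<Rightarrow> 'a set set \<Rightarrow> bool"
  assumes single: "\<And>u. P 1 {u} {}"
    and induced: "\<And>k V E W. P k V E \<Longrightarrow> V \<inter> W \<noteq> {} \<Longrightarrow> P k (V \<inter> W) {e \<in> E. e \<subseteq> W}"
    and insert_vertex: "\<And>k V E v N. P k V E \<Longrightarrow> v \<notin> V \<Longrightarrow> N \<subseteq> V \<Longrightarrow> 1 \<le> k \<Longrightarrow>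
      P (2 * k) (insert v V) (E \<union> {{v, v'} | v'. v' \<in> N})"
    and G: "simple_graph V E" "V \<noteq> {}" and v: "v \<notin> V" "N \<subseteq> V"
  defines "width \<equiv> \<lambda>V E. LEAST k. 1 \<le> k \<and> P k V E"
  defines "EH \<equiv> E \<union> {{v, v'} | v'. v' \<in> N}"
  shows "width V E \<le> width (insert v V) EH \<and> width (insert v V) EH \<le> 2 * width V E"
proof -
  have width_le: "width V' E' \<le> m" if "1 \<le> m" "P m V' E'" for m V' E'
    unfolding width_def using that by (intro Least_le) simp
  \<comment> \<open>A least value says something only if some value exists. The graph is built
    vertex by vertex with \<open>insert_vertex\<close>, doubling the number of labels each time;
    \<open>E\<close> is generalized because the induction hypothesis is applied to an induced
    subgraph.\<close>
  have "\<exists>k\<ge>1. P k V E"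
  proof -
    have "finite V" using G(1) by (simp add: simple_graph_def)
    then show ?thesis using G(2,1)
    proof (induction arbitrary: E rule: finite_ne_induct)
      case (singleton x)
      have "E = {}"
      proof (rule ccontr)
        assume "E \<noteq> {}"
        then obtain e where "e \<subseteq> {x}" "card e = 2"
          using singleton by (auto simp: simple_graph_def)
        then show False using card_mono[of "{x}" e] by simp
      qed
      then show ?case using single by auto
    next
      case (insert x F)
      let ?E = "{e \<in> E. e \<subseteq> F}" and ?N = "{u \<in> F. {x, u} \<in> E}"
      have "simple_graph F ?E" using insert.prems insert.hyps by (auto simp: simple_graph_def)
      then obtain k where k: "1 \<le> k" "P k F ?E" using insert.IH by blast
      have "E = ?E \<union> {{x, v'} |v'. v' \<in> ?N}"
      proof
        show "E \<subseteq> ?E \<union> {{x, v'} |v'. v' \<in> ?N}"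
        proof
          fix e assume e: "e \<in> E"
          then have *: "e \<subseteq> insert x F" "card e = 2" using insert.prems by (auto simp: simple_graph_def)
          show "e \<in> ?E \<union> {{x, v'} |v'. v' \<in> ?N}"
          proof (cases "x \<in> e")
            case True
            obtain y where "e = {x, y}" "y \<noteq> x"
              using *(2) True unfolding card_2_iff by blast
            then show ?thesis using * e by auto
          next
            case False
            then show ?thesis using * e by auto
          qed
        qed
      qed auto
      then have "P (2 * k) (insert x F) E"
        using insert_vertex[OF k(2) insert.hyps(3), of ?N] k(1) by auto
      then show ?case using k(1) by (intro exI[of _ "2 * k"]) auto
    qed
  qed
  then have G_width: "1 \<le> width V E" "P (width V E) V E"
    unfolding width_def by (metis (mono_tags, lifting) LeastI)+
  then have H: "1 \<le> 2 * width V E \<and> P (2 * width V E) (insert v V) EH"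
    using insert_vertex[OF G_width(2) v G_width(1)] by (simp add: EH_def)
  then have upper: "width (insert v V) EH \<le> 2 * width V E"
    by (simp add: width_le)
  \<comment> \<open>The upper bound also witnesses that the minimum for the extended graph is
    attained.\<close>
  have H_width: "1 \<le> width (insert v V) EH" "P (width (insert v V) EH) (insert v V) EH"
    using LeastI[of "\<lambda>k. 1 \<le> k \<and> P k (insert v V) EH", OF H] unfolding width_def by auto
  \<comment> \<open>Every added edge contains \<open>v\<close>, so the original graph is the
    subgraph induced on \<open>V\<close>; this yields the lower bound.\<close>
  have "{e \<in> EH. e \<subseteq> V} = E"
    using G(1) v by (auto simp: EH_def simple_graph_def)
  moreover have "insert v V \<inter> V = V" by auto
  ultimately have "P (width (insert v V) EH) V E"
    using induced[OF H_width(2), of V] G(2) by simp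
  then have "width V E \<le> width (insert v V) EH"
    using H_width(1) by (rule width_le[rotated])
  then show ?thesis using upper by simp
qed

theorem theorem11:
  fixes V :: "'a set" and E :: "'a set set" and v :: 'a and N :: "'a set"
  assumes "simple_graph V E" and "V \<noteq> {}"
    and "v \<notin> V" and "N \<subseteq> V"
  defines "VH \<equiv> V \<union> {v}" and "EH \<equiv> E \<union> {{v, v'} | v'. v' \<in> N}"
  shows "nlcw V E \<le> nlcw VH EH \<and> nlcw VH EH \<le> 2 * nlcw V E \<and>
         cw V E \<le> cw VH EH \<and> cw VH EH \<le> 2 * cw V E"
proof -
  have VH: "VH = insert v V" by (simp add: VH_def)
  have "nlcw V E \<le> nlcw VH EH \<and> nlcw VH EH \<le> 2 * nlcw V E"
    unfolding nlcw_def VH EH_def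
  proof (rule Least_width_insert_vertex[OF _ _ _ assms(1-4)])
    show "\<exists>lab. ({u}, {}, lab) \<in> NLC 1" for u :: 'a
      using NLC.single[of 1 1 u] by auto
  qed (blast intro: NLC_induced_subgraph NLC_insert_vertex)+
  moreover have "cw V E \<le> cw VH EH \<and> cw VH EH \<le> 2 * cw V E"
    unfolding cw_def VH EH_def
  proof (rule Least_width_insert_vertex[OF _ _ _ assms(1-4)])
    show "\<exists>lab. ({u}, {}, lab) \<in> CW 1" for u :: 'a
      using CW.single[of 1 1 u] by auto
  qed (blast intro: CW_induced_subgraph CW_insert_vertex)+
  ultimately show ?thesis by simp
qed

end
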